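(* Let $q\in\{2,3\}$. The only Cameron-Liebler line classes in $\mathrm{AG}(3,q)$ are the trivial ones, i.e. every Cameron-Liebler line class in $\mathrm{AG}(3,q)$ is either the empty set, the set of all lines through some affine point, the complement (in the set of all lines of $\mathrm{AG}(3,q)$) of the set of all lines through some affine point, or the set of all lines of $\mathrm{AG}(3,q)$.
   Context: $\mathrm{AG}(3,q)$ is the 3-dimensional affine space over $\mathbb{F}_q$. A line spread of $\mathrm{AG}(3,q)$ is a set of pairwise disjoint lines of $\mathrm{AG}(3,q)$ that partitions the points of $\mathrm{AG}(3,q)$. A Cameron-Liebler line class of parameter $x$ in $\mathrm{AG}(3,q)$ is a set $\mathcal{L}$ of lines of $\mathrm{AG}(3,q)$ such that $|\mathcal{L}\cap\mathcal{S}|=x$ for every line spread $\mathcal{S}$ of $\mathrm{AG}(3,q)$; a Cameron-Liebler line class is one of some parameter $x$. *)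

theory Defs
  imports "HOL-Analysis.Analysis"
begin

text \<open>
  A type \<open>'a\<close> of class \<open>{field, finite}\<close> with \<open>CARD('a) = q\<close> plays the role of the field with
  \<open>q\<close> elements. The points of \<open>AG(3,q)\<close> are the elements of \<open>'a ^ 3\<close>, and its lines are
  identified with their sets of points, i.e. the cosets of the one-dimensional subspaces.
\<close>

definition ag_lines :: "('a::{field,finite} ^ 3) set set" where
  "ag_lines = {{p + t *s v | t. True} | p v. v \<noteq> 0}"

definition ag_line_spread :: "('a::{field,finite} ^ 3) set set \<Rightarrow> bool" where
  "ag_line_spread S \<longleftrightarrow> S \<subseteq> ag_lines \<and> partition_on UNIV S"

definition cameron_liebler_param :: "nat \<Rightarrow> ('a::{field,finite} ^ 3) set set \<Rightarrow> bool" where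
  "cameron_liebler_param x L \<longleftrightarrow>
     L \<subseteq> ag_lines \<and> (\<forall>S. ag_line_spread S \<longrightarrow> card (L \<inter> S) = x)"

definition cameron_liebler :: "('a::{field,finite} ^ 3) set set \<Rightarrow> bool" where
  "cameron_liebler L \<longleftrightarrow> (\<exists>x. cameron_liebler_param x L)"

definition ag_lines_through :: "'a::{field,finite} ^ 3 \<Rightarrow> ('a ^ 3) set set" where
  "ag_lines_through p = {l \<in> ag_lines. p \<in> l}"

end

theory Submission
  imports Defs
begin

text \<open>
  Switching one plane of a parallel class of lines to another direction gives a new line spread,
  so for every plane \<open>\<pi>\<close> the number \<open>c(\<pi>)\<close> of lines of \<open>L\<close> in \<open>\<pi>\<close> with a given direction does not
  depend on the direction. Double counting then shows that, for a point \<open>p\<close>, the integer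
  \<open>h(p)\<close> = (number of lines of \<open>L\<close> in \<open>\<pi>\<close> through \<open>p\<close>) \<open>- c(\<pi>)\<close> is the same for all planes \<open>\<pi>\<close>
  through \<open>p\<close>, that \<open>h\<close> sums to \<open>q\<close> on the lines of \<open>L\<close> and to \<open>0\<close> on the other lines, and that
  \<open>1 - q \<le> h \<le> q\<close>. If \<open>h\<close> is constantly \<open>0\<close> modulo \<open>q\<close>, then \<open>h\<close> takes the value \<open>q\<close> at most once and is
  \<open>0\<close> elsewhere; if it is constantly \<open>1\<close>, the same applies to \<open>1 - h\<close>. This settles \<open>q = 2\<close>.
  For \<open>q = 3\<close>, \<open>h\<close> is an affine function modulo \<open>3\<close>. If it takes the value \<open>2\<close> modulo \<open>3\<close>, then
  \<open>h \<in> {-1, 2}\<close> on some plane, which 2-colours \<open>AG(2,3)\<close> without monochromatic lines; this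
  is impossible.
\<close>

section \<open>Lines by base point and direction, and independence of two directions\<close>

definition line :: "'a::{field,finite} ^ 3 \<Rightarrow> 'a ^ 3 \<Rightarrow> ('a ^ 3) set" where
  "line p v = range (\<lambda>t. p + t *s v)"

definition indep :: "'a::{field,finite} ^ 3 \<Rightarrow> 'a ^ 3 \<Rightarrow> bool" where
  "indep v w \<longleftrightarrow> (\<forall>a b. a *s v + b *s w = 0 \<longrightarrow> a = 0 \<and> b = 0)"

lemma ag_lines_eq: "ag_lines = {line p v | p v. v \<noteq> 0}"
  unfolding ag_lines_def line_def by (simp add: full_SetCompr_eq)

lemma line_in_ag_lines: "v \<noteq> 0 \<Longrightarrow> line p v \<in> ag_lines"
  unfolding ag_lines_eq by blast

lemma mem_line: "y \<in> line p v \<longleftrightarrow> (\<exists>t. y = p + t *s v)"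
  unfolding line_def by blast

lemma line_base [simp]: "p \<in> line p v"
  unfolding mem_line by (rule exI[of _ 0]) simp

lemma line_shift [simp]: "line (p + t *s v) v = line p v"
proof -
  have "p + t *s v + s *s v = p + (t + s) *s v" for s
    by (simp add: vec.scale_left_distrib)
  moreover have "p + s *s v = p + t *s v + (s - t) *s v" for s
    by (simp add: vec.scale_left_diff_distrib)
  ultimately show ?thesis
    unfolding set_eq_iff mem_line by metis
qed

lemma line_eq: "y \<in> line p v \<Longrightarrow> line y v = line p v"
  by (auto simp: mem_line)

lemma line_scale:
  assumes "s \<noteq> 0" shows "line p (s *s v) = line p v"
proof -
  have "p + t *s v = p + (t / s) *s (s *s v)" for t
    using assms by simp
  then show ?thesis
    unfolding set_eq_iff mem_line by (metis vec.scale_scale)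
qed

lemma card_line:
  assumes "v \<noteq> 0" shows "card (line p v :: ('a::{field,finite} ^ 3) set) = CARD('a)"
proof -
  have "inj (\<lambda>t. p + t *s v)"
    using assms by (auto simp: inj_def)
  then show ?thesis unfolding line_def by (simp add: card_image)
qed

lemma indep_sym: "indep v w \<Longrightarrow> indep w v"
  unfolding indep_def by (metis add.commute)

lemma indep_nonzero: "indep v w \<Longrightarrow> v \<noteq> 0"
  unfolding indep_def by (metis add.right_neutral vec.scale_zero_left vec.scale_zero_right zero_neq_one)

lemma indep_nonzero2: "indep v w \<Longrightarrow> w \<noteq> 0"
  using indep_nonzero indep_sym by blast

lemma indep_coords:
  assumes "indep v w" "a *s v + b *s w = c *s v + d *s w"
  shows "a = c \<and> b = d"
proof -
  have "(a - c) *s v + (b - d) *s w = 0"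
    using assms(2) by (simp add: vec.scale_left_diff_distrib algebra_simps)
  then show ?thesis using assms(1) unfolding indep_def by fastforce
qed

lemma indep_iff:
  assumes "v \<noteq> 0" shows "indep v w \<longleftrightarrow> w \<notin> range (\<lambda>t. t *s v)"
proof
  assume "indep v w"
  then show "w \<notin> range (\<lambda>t. t *s v)"
    using indep_coords[of v w _ 0 0 1] by auto
next
  assume *: "w \<notin> range (\<lambda>t. t *s v)"
  show "indep v w" unfolding indep_def
  proof (intro allI impI)
    fix a b assume ab: "a *s v + b *s w = 0"
    have "b = 0"
    proof (rule ccontr)
      assume "b \<noteq> 0"
      have "b *s w = (- a) *s v" using ab by (simp add: eq_neg_iff_add_eq_0 add.commute)
      then have "(1/b) *s (b *s w) = (- a / b) *s v" by (simp add: \<open>b \<noteq> 0\<close>)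
      then have "w = (- a / b) *s v" using \<open>b \<noteq> 0\<close> by simp
      then show False using * by blast
    qed
    then show "a = 0 \<and> b = 0" using ab assms by simp
  qed
qed

lemma indep_add_scale:
  assumes "indep v w" shows "indep v (w + s *s v)"
  unfolding indep_def
proof (intro allI impI)
  fix a b assume "a *s v + b *s (w + s *s v) = 0"
  then have "(a + b * s) *s v + b *s w = 0"
    by (simp add: algebra_simps vec.scale_right_distrib vec.scale_left_distrib)
  then show "a = 0 \<and> b = 0"
    using assms unfolding indep_def by fastforce
qed

lemma not_indep_parallel_lines:
  assumes "line p v = line y w" shows "\<not> indep v w"
proof
  assume i: "indep v w"
  have "p \<in> line y w" "p + 1 *s v \<in> line y w"
    using assms line_base[of p v] mem_line[of "p + 1 *s v" p v] by blast+
  then obtain s t where "p = y + s *s w" "p + 1 *s v = y + t *s w"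
    unfolding mem_line by blast
  then have "1 *s v + 0 *s w = 0 *s v + (t - s) *s w"
    by (simp add: vec.scale_left_diff_distrib algebra_simps)
  then show False using indep_coords[OF i] by fastforce
qed

section \<open>Line spreads: parallel classes and their switching in one plane\<close>

definition parallel_class :: "'a::{field,finite} ^ 3 \<Rightarrow> ('a ^ 3) set set" where
  "parallel_class v = range (\<lambda>y. line y v)"

lemma spread_parallel_class:
  assumes "v \<noteq> 0" shows "ag_line_spread (parallel_class v)"
  unfolding ag_line_spread_def
proof
  show "parallel_class v \<subseteq> ag_lines"
    using assms by (auto simp: parallel_class_def line_in_ag_lines)
  show "partition_on UNIV (parallel_class v)"
  proof (rule partition_onI)
    fix l m assume "l \<in> parallel_class v" "m \<in> parallel_class v" "l \<noteq> m"
    then show "disjnt l m"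
      unfolding parallel_class_def disjnt_iff using line_eq by blast
  qed (use line_base in \<open>auto simp: parallel_class_def, blast\<close>)
qed

text \<open>\<open>A\<close> and \<open>B\<close> cover the same points, the plane through
  \<open>p\<close> spanned by \<open>v\<close> and \<open>w\<close>, so exchanging them keeps a
  partition.\<close>

lemma spread_switch_plane:
  fixes p :: "'a::{field,finite} ^ 3"
  assumes i: "indep v w"
  defines "A \<equiv> range (\<lambda>t. line (p + t *s w) v)"
    and "B \<equiv> range (\<lambda>t. line (p + t *s v) w)"
  shows "ag_line_spread (parallel_class v - A \<union> B)"
  unfolding ag_line_spread_def
proof
  have v: "v \<noteq> 0" and w: "w \<noteq> 0" using i indep_nonzero indep_nonzero2 by auto
  show "parallel_class v - A \<union> B \<subseteq> ag_lines"
    using v w by (auto simp: parallel_class_def B_def line_in_ag_lines)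
  have AB: "\<Union>A = \<Union>B"
    unfolding A_def B_def
    by (auto simp: mem_line algebra_simps) (metis add.commute)+
  have part: "partition_on UNIV (parallel_class v)"
    using spread_parallel_class[OF v] by (simp add: ag_line_spread_def)
  have AS: "A \<subseteq> parallel_class v" by (auto simp: A_def parallel_class_def)
  show "partition_on UNIV (parallel_class v - A \<union> B)"
  proof (rule partition_onI)
    show "\<Union> (parallel_class v - A \<union> B) = UNIV"
      using partition_onD1[OF part] AB by blast
  next
    show "{} \<notin> parallel_class v - A \<union> B"
      using line_base unfolding parallel_class_def B_def by blast
  next
    fix l m assume lm: "l \<in> parallel_class v - A \<union> B" "m \<in> parallel_class v - A \<union> B" "l \<noteq> m"
    have dA: "disjnt k n" if "k \<in> parallel_class v - A" "n \<in> B" for k n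
    proof -
      have "k \<inter> a = {}" if "a \<in> A" for a
        using disjointD[OF partition_onD2[OF part], of k a] \<open>k \<in> _\<close> AS that by auto
      then have "k \<inter> \<Union>A = {}" by blast
      then show ?thesis using that AB by (auto simp: disjnt_def)
    qed
    have dB: "disjnt k n" if "k \<in> B" "n \<in> B" "k \<noteq> n" for k n
    proof -
      obtain s t where "k = line (p + s *s v) w" "n = line (p + t *s v) w"
        using \<open>k \<in> B\<close> \<open>n \<in> B\<close> unfolding B_def by blast
      then show ?thesis
        using \<open>k \<noteq> n\<close> line_eq[of _ "p + s *s v" w] line_eq[of _ "p + t *s v" w]
        unfolding disjnt_iff by metis
    qed
    have dS: "disjnt k n" if "k \<in> parallel_class v - A" "n \<in> parallel_class v - A" "k \<noteq> n" for k n
      using disjointD[OF partition_onD2[OF part], of k n] that by (simp add: disjnt_def)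
    show "disjnt l m"
      using lm dA[of l m] dA[of m l] dB[of l m] dS[of l m] by (auto simp: disjnt_sym)
  qed
qed

lemma sum_affine:
  fixes g :: "'a::{field,finite} ^ 3 \<Rightarrow> int"
  assumes "t \<noteq> 0"
  shows "(\<Sum>w\<in>UNIV. g (p + t *s w)) = (\<Sum>y\<in>UNIV. g y)"
  using assms
  by (intro sum.reindex_bij_witness[of _ "\<lambda>y. (1/t) *s (y - p)" "\<lambda>w. p + t *s w"]) auto

lemma sum_scale:
  fixes g :: "'a::{field,finite} \<Rightarrow> int"
  assumes "t \<noteq> 0"
  shows "(\<Sum>s\<in>UNIV. g (t * s)) = (\<Sum>s\<in>UNIV. g s)"
  using assms
  by (intro sum.reindex_bij_witness[of _ "\<lambda>y. y / t" "\<lambda>w. t * w"]) auto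

section \<open>Counting lines of the class by direction, plane and point\<close>

locale cl_class =
  fixes L :: "('a::{field,finite} ^ 3) set set" and x :: nat and q :: int
  assumes cl: "cameron_liebler_param x L"
    and q_eq [simp]: "q = int CARD('a)"
begin

definition F :: "'a ^ 3 \<Rightarrow> 'a ^ 3 \<Rightarrow> int" where
  "F v p = of_bool (line p v \<in> L)"

text \<open>For independent \<open>v\<close>, \<open>w\<close> this counts the lines of
  \<open>L\<close> with direction \<open>v\<close> in a plane. A multiple \<open>w\<close> of
  \<open>v\<close> is also meaningful and yields \<open>q * F v p\<close>.\<close>

definition C :: "'a ^ 3 \<Rightarrow> 'a ^ 3 \<Rightarrow> 'a ^ 3 \<Rightarrow> int" where
  "C p v w = (\<Sum>t\<in>UNIV. F v (p + t *s w))"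

text \<open>Each line of \<open>L\<close> through \<open>p\<close> is counted \<open>q - 1\<close>
  times, once for each of its direction vectors.\<close>

definition D :: "'a ^ 3 \<Rightarrow> int" where
  "D p = (\<Sum>v\<in>-{0}. F v p)"

lemma F_shift [simp]: "F v (p + t *s v) = F v p"
  by (simp add: F_def)

lemma F_scale: "s \<noteq> 0 \<Longrightarrow> F (s *s v) p = F v p"
  by (simp add: F_def line_scale)

lemma F_bounds: "0 \<le> F v p" "F v p \<le> 1"
  by (simp_all add: F_def)

lemma q_ge_2: "q \<ge> 2"
proof -
  have "card {0, 1::'a} \<le> CARD('a)" by (rule card_mono) auto
  then show ?thesis by simp
qed

lemma spread_card: "ag_line_spread S \<Longrightarrow> card (L \<inter> S) = x"
  using cl by (simp add: cameron_liebler_param_def)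

lemma sum_F_direction:
  assumes v: "v \<noteq> 0" shows "(\<Sum>y\<in>UNIV. F v y) = q * int x"
proof -
  have part: "partition_on UNIV (parallel_class v)"
    using spread_parallel_class[OF v] by (simp add: ag_line_spread_def)
  have "(\<Sum>y\<in>UNIV. F v y) = (\<Sum>y\<in>\<Union>(parallel_class v). F v y)"
    using partition_onD1[OF part] by simp
  also have "\<dots> = (\<Sum>l\<in>parallel_class v. \<Sum>y\<in>l. F v y)"
    using partition_onD2[OF part] by (subst sum.Union_disjoint) (auto simp: disjoint_def)
  also have "\<dots> = (\<Sum>l\<in>parallel_class v. q * of_bool (l \<in> L))"
  proof (rule sum.cong[OF refl])
    fix l assume "l \<in> parallel_class v"
    then obtain p where l: "l = line p v" by (auto simp: parallel_class_def)
    have "F v y = of_bool (l \<in> L)" if "y \<in> l" for y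
      using line_eq[of y p v] that by (simp add: l F_def)
    then show "(\<Sum>y\<in>l. F v y) = q * of_bool (l \<in> L)"
      by (simp add: l card_line[OF v])
  qed
  also have "\<dots> = q * int (card (L \<inter> parallel_class v))"
    by (simp add: sum_distrib_left[symmetric] Int_commute)
  finally show ?thesis
    using spread_card[OF spread_parallel_class[OF v]] by simp
qed

lemma C_eq_card:
  assumes "indep v w"
  shows "C p v w = int (card (L \<inter> range (\<lambda>t. line (p + t *s w) v)))"
proof -
  have inj: "inj (\<lambda>t. line (p + t *s w) v)"
  proof (rule injI)
    fix s t assume "line (p + s *s w) v = line (p + t *s w) v"
    then have "p + s *s w \<in> line (p + t *s w) v" using line_base by blast
    then obtain r where "0 *s v + s *s w = r *s v + t *s w"
      by (auto simp: mem_line algebra_simps)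
    then show "s = t" using indep_coords[OF assms] by blast
  qed
  have "L \<inter> range (\<lambda>t. line (p + t *s w) v) = (\<lambda>t. line (p + t *s w) v) ` {t. line (p + t *s w) v \<in> L}"
    by blast
  then have "card (L \<inter> range (\<lambda>t. line (p + t *s w) v)) = card {t. line (p + t *s w) v \<in> L}"
    using inj by (simp add: card_image inj_on_subset[OF inj])
  then show ?thesis by (simp add: C_def F_def)
qed

text \<open>A parallel class and its switching meet \<open>L\<close> equally often. They differ only
  in \<open>?A\<close> and \<open>?B\<close>, so these do as well.\<close>

lemma C_sym:
  assumes i: "indep v w" shows "C p v w = C p w v"
proof -
  let ?A = "range (\<lambda>t. line (p + t *s w) v)"
  let ?B = "range (\<lambda>t. line (p + t *s v) w)"
  let ?S = "parallel_class v"
  have "line z w \<noteq> line y v" for y z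
    using not_indep_parallel_lines[of y v z w] i by metis
  then have BS: "?B \<inter> ?S = {}"
    by (auto simp: parallel_class_def)
  have AS: "?A \<subseteq> ?S" by (auto simp: parallel_class_def)
  have "card (L \<inter> (?S - ?A \<union> ?B)) = card (L \<inter> ?S)"
    using spread_card spread_switch_plane[OF i] spread_parallel_class[OF indep_nonzero[OF i]] by simp
  moreover have "card (L \<inter> (?S - ?A \<union> ?B)) = card (L \<inter> (?S - ?A)) + card (L \<inter> ?B)"
    using BS by (subst card_Un_disjoint[symmetric]) (auto simp: Int_Un_distrib)
  moreover have "L \<inter> ?S = (L \<inter> (?S - ?A)) \<union> (L \<inter> ?A)" using AS by blast
  then have "card (L \<inter> ?S) = card (L \<inter> (?S - ?A)) + card (L \<inter> ?A)"
    by (simp only:) (subst card_Un_disjoint, auto)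
  ultimately show ?thesis
    using C_eq_card[OF i] C_eq_card[OF indep_sym[OF i]] by simp
qed

text \<open>
  Obtained by summing \<open>C p v w\<close> over all \<open>w\<close>, including the multiples of \<open>v\<close>: every plane through
  the line is then counted equally often, and no planes have to be enumerated.
\<close>

lemma sum_D_line:
  assumes v: "v \<noteq> 0"
  shows "(\<Sum>t\<in>UNIV. D (p + t *s v)) = (q - 1) * q * int x + q * (q - 1) * (q + 1) * F v p"
proof -
  let ?S = "range (\<lambda>t. t *s v)"
  have inj: "inj (\<lambda>t. t *s v)" using v by (auto simp: inj_def)
  have cardS: "card ?S = CARD('a)" using inj by (simp add: card_image)
  have "(\<Sum>w\<in>UNIV. C p v w) = (\<Sum>t\<in>UNIV. \<Sum>w\<in>UNIV. F v (p + t *s w))"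
    unfolding C_def by (rule sum.swap)
  also have "\<dots> = (\<Sum>w\<in>(UNIV::('a^3) set). F v p) + (\<Sum>t\<in>-{0}. \<Sum>w\<in>UNIV. F v (p + t *s w))"
    by (subst sum.remove[of _ 0]) (auto simp: Compl_eq_Diff_UNIV)
  \<comment> \<open>For nonzero \<open>t\<close> the point \<open>p + t *s w\<close> runs over the
    whole space.\<close>
  also have "(\<Sum>t\<in>-{0}. \<Sum>w\<in>UNIV. F v (p + t *s w)) = (\<Sum>t\<in>-{0::'a}. q * int x)"
    using sum_affine[where g = "F v"] sum_F_direction[OF v] by (intro sum.cong) auto
  also have "(\<Sum>t\<in>-{0::'a}. q * int x) = (q - 1) * (q * int x)"
    by (simp add: Compl_eq_Diff_UNIV card_Diff_singleton of_nat_diff)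
  finally have 1: "(\<Sum>w\<in>UNIV. C p v w) = q ^ 3 * F v p + (q - 1) * (q * int x)"
    by simp
  have 2: "(\<Sum>w\<in>?S. C p v w) = q * (q * F v p)"
  proof -
    have "C p v w = q * F v p" if "w \<in> ?S" for w
      using that by (auto simp: C_def)
    then show ?thesis by (simp add: cardS)
  qed
  \<comment> \<open>For independent directions \<open>C_sym\<close> moves the sum onto the points of
    the line through \<open>p\<close> with direction \<open>v\<close>. There it is \<open>D\<close>
    without the \<open>q - 1\<close> vectors that give this line itself.\<close>
  have 3: "(\<Sum>w\<in>-?S. C p v w) = (\<Sum>w\<in>-?S. \<Sum>t\<in>UNIV. F w (p + t *s v))"
  proof (rule sum.cong[OF refl])
    fix w assume "w \<in> -?S"
    then have "indep v w" using indep_iff[OF v] by blast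
    then show "C p v w = (\<Sum>t\<in>UNIV. F w (p + t *s v))"
      using C_sym[of v w p] by (simp add: C_def)
  qed
  also have "\<dots> = (\<Sum>t\<in>UNIV. \<Sum>w\<in>-?S. F w (p + t *s v))" by (rule sum.swap)
  also have "\<dots> = (\<Sum>t\<in>UNIV. D (p + t *s v) - (q - 1) * F v p)"
  proof (rule sum.cong[OF refl])
    fix t
    have z: "0 \<in> ?S" by (rule range_eqI[of _ _ 0]) simp
    then have "-{0} = -?S \<union> (?S - {0})" by blast
    then have "D (p + t *s v) = (\<Sum>w\<in>-?S. F w (p + t *s v)) + (\<Sum>w\<in>?S - {0}. F w (p + t *s v))"
      unfolding D_def by (simp only:) (subst sum.union_disjoint, auto)
    also have "(\<Sum>w\<in>?S - {0}. F w (p + t *s v)) = (\<Sum>w\<in>?S - {0}. F v p)"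
      by (rule sum.cong[OF refl]) (auto simp: F_scale)
    also have "\<dots> = (q - 1) * F v p"
      using z by (simp add: card_Diff_singleton cardS of_nat_diff)
    finally show "(\<Sum>w\<in>-?S. F w (p + t *s v)) = D (p + t *s v) - (q - 1) * F v p" by simp
  qed
  also have "\<dots> = (\<Sum>t\<in>UNIV. D (p + t *s v)) - q * ((q - 1) * F v p)"
    by (simp add: sum_subtractf)
  finally have 4: "(\<Sum>w\<in>-?S. C p v w) = (\<Sum>t\<in>UNIV. D (p + t *s v)) - q * ((q - 1) * F v p)" .
  have "(\<Sum>w\<in>UNIV. C p v w) = (\<Sum>w\<in>?S. C p v w) + (\<Sum>w\<in>-?S. C p v w)"
    by (subst sum.union_disjoint[symmetric]) auto
  with 1 2 4 show ?thesis
    by (simp add: algebra_simps power3_eq_cube)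
qed

text \<open>
  The vectors \<open>v\<close> and \<open>w + s *s v\<close> represent each direction of the plane spanned by \<open>v\<close> and \<open>w\<close> once.
\<close>

definition H :: "'a ^ 3 \<Rightarrow> 'a ^ 3 \<Rightarrow> 'a ^ 3 \<Rightarrow> int" where
  "H v w p = F v p + (\<Sum>s\<in>UNIV. F (w + s *s v) p) - C p v w"

text \<open>Sum \<open>D\<close> over the lines through \<open>p\<close> with directions
  \<open>w + s *s v\<close>: they cover \<open>p\<close> exactly \<open>q\<close> times and each
  point of the plane off the line with direction \<open>v\<close> once. Evaluating with
  \<open>sum_D_line\<close> isolates \<open>D p\<close>. As \<open>D p\<close> does not involve
  \<open>v\<close> and \<open>w\<close>, neither does the value of \<open>H v w p\<close>.\<close>

lemma D_eq_H:
  assumes i: "indep v w"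
  shows "D p = (q - 1) * (int x + (q + 1) * H v w p)"
proof -
  have v: "v \<noteq> 0" using i indep_nonzero by blast
  let ?T = "\<Sum>s\<in>UNIV. F (w + s *s v) p"
  let ?P = "\<Sum>t\<in>UNIV. \<Sum>s\<in>UNIV. D (p + t *s w + s *s v)"
  let ?k = "q * (q - 1) * (q + 1)"
  let ?R = "\<Sum>s\<in>UNIV. \<Sum>t\<in>UNIV. D (p + t *s (w + s *s v))"
  have P: "?P = q * ((q - 1) * q * int x) + ?k * C p v w"
    by (simp add: sum_D_line[OF v] sum.distrib C_def sum_distrib_left)
  have "w + s *s v \<noteq> 0" for s
    using indep_nonzero2[OF indep_add_scale[OF i]] .
  then have "?R = (\<Sum>s\<in>UNIV. (q - 1) * q * int x + ?k * F (w + s *s v) p)"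
    by (intro sum.cong sum_D_line) auto
  then have R1: "?R = q * ((q - 1) * q * int x) + ?k * ?T"
    by (simp add: sum.distrib sum_distrib_left)
  have "?R = (\<Sum>t\<in>UNIV. \<Sum>s\<in>UNIV. D (p + t *s (w + s *s v)))" by (rule sum.swap)
  also have "\<dots> = (\<Sum>s\<in>(UNIV::'a set). D p) + (\<Sum>t\<in>-{0}. \<Sum>s\<in>UNIV. D (p + t *s (w + s *s v)))"
    by (subst sum.remove[of _ 0]) (auto simp: Compl_eq_Diff_UNIV)
  \<comment> \<open>For nonzero \<open>t\<close> the factor in \<open>t * s\<close> only permutes
    the values of \<open>s\<close>.\<close>
  also have "(\<Sum>t\<in>-{0}. \<Sum>s\<in>UNIV. D (p + t *s (w + s *s v)))
      = (\<Sum>t\<in>-{0}. \<Sum>s\<in>UNIV. D (p + t *s w + s *s v))"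
  proof (rule sum.cong[OF refl])
    fix t :: 'a assume "t \<in> -{0}"
    then have "(\<Sum>s\<in>UNIV. D (p + t *s w + (t * s) *s v)) = (\<Sum>s\<in>UNIV. D (p + t *s w + s *s v))"
      using sum_scale[of t "\<lambda>s. D (p + t *s w + s *s v)"] by simp
    then show "(\<Sum>s\<in>UNIV. D (p + t *s (w + s *s v))) = (\<Sum>s\<in>UNIV. D (p + t *s w + s *s v))"
      by (simp add: vec.scale_right_distrib add.assoc)
  qed
  also have "\<dots> = ?P - (\<Sum>s\<in>UNIV. D (p + s *s v))"
    by (subst sum.remove[of UNIV 0]) (auto simp: Compl_eq_Diff_UNIV)
  finally have "?R = q * D p + ?P - ((q - 1) * q * int x + ?k * F v p)"
    by (simp add: sum_D_line[OF v])
  with P R1 have "q * D p = q * ((q - 1) * (int x + (q + 1) * H v w p))"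
    unfolding H_def by (simp add: algebra_simps)
  then show ?thesis by simp
qed

text \<open>\<open>F v p\<close> cancels against the summand \<open>t = 0\<close> of
  \<open>C\<close>, which leaves \<open>q\<close> indicators minus \<open>q - 1\<close>
  others.\<close>

lemma H_bounds:
  assumes "indep v w"
  shows "1 - q \<le> H v w p" "H v w p \<le> q"
proof -
  have "C p v w = F v p + (\<Sum>t\<in>-{0}. F v (p + t *s w))"
    unfolding C_def by (subst sum.remove[of _ 0]) (auto simp: Compl_eq_Diff_UNIV)
  moreover have "(\<Sum>t\<in>-{0}. F v (p + t *s w)) \<le> (\<Sum>t\<in>-{0::'a}. 1)"
    by (rule sum_mono) (rule F_bounds)
  moreover have "(\<Sum>t\<in>-{0::'a}. 1) = q - 1"
    by (simp add: Compl_eq_Diff_UNIV card_Diff_singleton of_nat_diff)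
  moreover have "(\<Sum>t\<in>-{0}. F v (p + t *s w)) \<ge> 0"
    by (rule sum_nonneg) (rule F_bounds)
  moreover have "(\<Sum>s\<in>UNIV. F (w + s *s v) p) \<le> (\<Sum>s\<in>(UNIV::'a set). 1)"
    by (rule sum_mono) (rule F_bounds)
  moreover have "(\<Sum>s\<in>UNIV. F (w + s *s v) p) \<ge> 0"
    by (rule sum_nonneg) (rule F_bounds)
  ultimately show "1 - q \<le> H v w p" "H v w p \<le> q"
    unfolding H_def by auto
qed

text \<open>By \<open>D_eq_H\<close> every other independent pair gives the same function.\<close>

definition h :: "'a ^ 3 \<Rightarrow> int" where
  "h = H (axis 1 1) (axis 2 1)"

lemma indep_axis: "i \<noteq> j \<Longrightarrow> indep (axis i 1) (axis j (1::'a))"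
  unfolding indep_def by (auto simp: vec_eq_iff axis_def split: if_splits)

lemma h_bounds: "1 - q \<le> h p" "h p \<le> q"
  using H_bounds[OF indep_axis[of 1 2]] by (auto simp: h_def)

lemma D_eq_h: "D p = (q - 1) * (int x + (q + 1) * h p)"
  using D_eq_H[OF indep_axis[of 1 2]] by (simp add: h_def)

lemma sum_h_line:
  assumes v: "v \<noteq> 0"
  shows "(\<Sum>t\<in>UNIV. h (p + t *s v)) = q * F v p"
proof -
  have "(q - 1) * (q * int x + (q + 1) * (\<Sum>t\<in>UNIV. h (p + t *s v))) = (\<Sum>t\<in>UNIV. D (p + t *s v))"
    by (simp add: D_eq_h sum_distrib_left[symmetric] sum.distrib)
  also have "\<dots> = (q - 1) * (q * int x + (q + 1) * (q * F v p))"
    by (simp add: sum_D_line[OF v] algebra_simps)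
  finally show ?thesis using q_ge_2 by simp
qed

lemma sum_h_ag_line:
  assumes "l \<in> ag_lines"
  shows "(\<Sum>z\<in>l. h z) = q * of_bool (l \<in> L)"
proof -
  obtain p v where l: "l = line p v" and v: "v \<noteq> 0"
    using assms unfolding ag_lines_eq by blast
  have "inj (\<lambda>t. p + t *s v)" using v by (auto simp: inj_def)
  then have "(\<Sum>z\<in>l. h z) = (\<Sum>t\<in>UNIV. h (p + t *s v))"
    unfolding l line_def by (simp add: sum.reindex)
  then show ?thesis by (simp add: sum_h_line[OF v] F_def l)
qed

section \<open>From residues of \<open>h\<close> modulo \<open>q\<close> to trivial line
  classes\<close>

lemma card_ag_line: "l \<in> ag_lines \<Longrightarrow> int (card (l :: ('a ^ 3) set)) = q"
  unfolding ag_lines_eq using card_line by fastforce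

text \<open>Kept general in \<open>k\<close> and \<open>M\<close> to serve both \<open>L\<close>
  with \<open>h\<close> and its complement with \<open>1 - h\<close>. As \<open>k\<close> is
  nonnegative, two points of value \<open>q\<close> would force a line sum of at least
  \<open>2 * q\<close>.\<close>

lemma empty_or_star:
  fixes k :: "'a ^ 3 \<Rightarrow> int"
  assumes M: "M \<subseteq> ag_lines"
    and sum: "\<And>l. l \<in> ag_lines \<Longrightarrow> (\<Sum>z\<in>l. k z) = q * of_bool (l \<in> M)"
    and k: "\<And>z. k z = 0 \<or> k z = q"
  shows "M = {} \<or> (\<exists>p. M = ag_lines_through p)"
proof (cases "\<exists>p. k p = q")
  case True
  then obtain p where p: "k p = q" by blast
  have k_eq: "k z = (if z = p then q else 0)" for z
  proof (rule ccontr)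
    assume *: "k z \<noteq> (if z = p then q else 0)"
    then have z: "z \<noteq> p" "k z = q" using p k[of z] by (auto split: if_splits)
    define l where "l = line p (z - p)"
    have l: "l \<in> ag_lines" using z by (simp add: l_def line_in_ag_lines)
    have "z = p + 1 *s (z - p)" by simp
    then have "{p, z} \<subseteq> l" unfolding l_def using line_base mem_line by blast
    then have "(\<Sum>y\<in>{p, z}. k y) \<le> (\<Sum>y\<in>l. k y)"
      using k by (intro sum_mono2) (auto, metis of_nat_0_le_iff order_refl)
    moreover have "(\<Sum>y\<in>{p, z}. k y) = 2 * q" using z p by simp
    ultimately show False using sum[OF l] q_ge_2 by (cases "l \<in> M") auto
  qed
  have "l \<in> M \<longleftrightarrow> p \<in> l" if "l \<in> ag_lines" for l
    using sum[OF that] q_ge_2 by (auto simp: k_eq split: if_splits)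
  then have "M = ag_lines_through p" using M unfolding ag_lines_through_def by blast
  then show ?thesis by blast
next
  case False
  then have "k z = 0" for z using k by blast
  then have "l \<notin> M" if "l \<in> ag_lines" for l
    using sum[OF that] q_ge_2 by auto
  then show ?thesis using M by blast
qed

lemma L_subset: "L \<subseteq> ag_lines"
  using cl by (simp add: cameron_liebler_param_def)

lemma trivial_of_h_cong_0:
  assumes "\<And>p. q dvd h p"
  shows "L = {} \<or> (\<exists>p. L = ag_lines_through p)"
proof (rule empty_or_star[OF L_subset sum_h_ag_line])
  fix z
  obtain c where c: "h z = q * c" using assms[of z] by (auto simp: dvd_def)
  \<comment> \<open>The only multiples of \<open>q\<close> between \<open>1 - q\<close> and
    \<open>q\<close> are \<open>0\<close> and \<open>q\<close>.\<close>
  have "q * (-1) < q * c" "q * c \<le> q * 1" using h_bounds[of z] c by linarith+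
  then have "c = 0 \<or> c = 1" using q_ge_2 by (simp only: mult_less_cancel_left mult_le_cancel_left) auto
  then show "h z = 0 \<or> h z = q" using c by auto
qed

text \<open>The function \<open>1 - h\<close> has the same bounds as \<open>h\<close>, and a line
  has \<open>q\<close> points, so it sums to \<open>q\<close> exactly on the lines outside
  \<open>L\<close>.\<close>

lemma trivial_of_h_cong_1:
  assumes "\<And>p. q dvd 1 - h p"
  shows "L = ag_lines \<or> (\<exists>p. L = ag_lines - ag_lines_through p)"
proof -
  have "ag_lines - L = {} \<or> (\<exists>p. ag_lines - L = ag_lines_through p)"
  proof (rule empty_or_star[where k = "\<lambda>z. 1 - h z"])
    fix z
    obtain c where c: "1 - h z = q * c" using assms[of z] by (auto simp: dvd_def)
    have "q * (-1) < q * c" "q * c \<le> q * 1" using h_bounds[of z] c by linarith+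
    then have "c = 0 \<or> c = 1" using q_ge_2 by (simp only: mult_less_cancel_left mult_le_cancel_left) auto
    then show "1 - h z = 0 \<or> 1 - h z = q" using c by auto
  next
    fix l :: "('a ^ 3) set" assume l: "l \<in> ag_lines"
    show "(\<Sum>z\<in>l. 1 - h z) = q * of_bool (l \<in> ag_lines - L)"
      using l by (simp add: sum_subtractf sum_h_ag_line card_ag_line)
  qed auto
  then show ?thesis using L_subset by blast
qed

section \<open>The case \<open>q = 2\<close>\<close>

lemma classification_2:
  assumes "CARD('a) = 2"
  shows "L = {} \<or> (\<exists>p. L = ag_lines_through p) \<or>
    (\<exists>p. L = ag_lines - ag_lines_through p) \<or> L = ag_lines"
proof -
  have U: "UNIV = {0, 1::'a}"
    using assms by (intro card_subset_eq[symmetric]) auto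
  \<comment> \<open>For nonzero \<open>v\<close> the points \<open>0\<close> and \<open>v\<close>
    form a whole line.\<close>
  have "even (h 0 + h v)" for v
  proof (cases "v = 0")
    case False
    then show ?thesis using sum_h_line[of v 0] assms by (simp add: U)
  qed simp
  then have "even (h v) \<longleftrightarrow> even (h 0)" for v by (metis even_add)
  then have "(\<forall>v. q dvd h v) \<or> (\<forall>v. q dvd 1 - h v)" using assms by auto
  then show ?thesis using trivial_of_h_cong_0 trivial_of_h_cong_1 by blast
qed

end

section \<open>The case \<open>q = 3\<close>: characteristic 3 and \<open>h\<close> modulo 3\<close>

lemma of_nat_CARD_eq_0: "of_nat CARD('a) = (0 :: 'a::{field,finite})"
proof -
  \<comment> \<open>Translation by \<open>1\<close> permutes the field, so the ones must sum to
    \<open>0\<close>.\<close>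
  have "(\<Sum>y\<in>UNIV. 1 + y) = (\<Sum>y\<in>UNIV. y :: 'a)"
    by (rule sum.reindex_bij_witness[of _ "\<lambda>y. y - 1" "\<lambda>w. 1 + w"]) auto
  then show ?thesis by (simp add: sum.distrib)
qed

locale cl_class_3 = cl_class L x q for L :: "('a::{field,finite} ^ 3) set set" and x q +
  assumes card3: "CARD('a) = 3"
begin

lemma h_bounds_3: "- 2 \<le> h p" "h p \<le> 3"
  using h_bounds[of p] card3 by simp_all

lemma three_eq_0: "(3 :: 'a) = 0"
  using of_nat_CARD_eq_0[where 'a = 'a] card3 by simp

lemma two_eq: "(2 :: 'a) = -1"
  using three_eq_0 by (simp add: eq_neg_iff_add_eq_0)

lemma one_neq_minus_one: "(1 :: 'a) \<noteq> -1"
proof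
  assume *: "(1 :: 'a) = -1"
  have "(2 :: 'a) = 1 + 1" by simp
  also have "\<dots> = 1 + - 1" using * by (rule arg_cong)
  finally show False using two_eq by simp
qed

lemma UNIV_3: "UNIV = {0, 1, -1 :: 'a}"
  using card3 one_neq_minus_one by (intro card_subset_eq[symmetric]) auto

lemma line_sum_3:
  assumes "v \<noteq> 0" shows "h p + h (p + v) + h (p - v) = 3 * F v p"
  using sum_h_line[OF assms, of p] card3 one_neq_minus_one by (simp add: UNIV_3)

lemma line_sum_dvd: "3 dvd h p + h (p + v) + h (p - v)"
  by (cases "v = 0") (simp_all add: line_sum_3)

text \<open>In characteristic 3 the third point of the line through \<open>a\<close> and
  \<open>b\<close> is \<open>- a - b\<close>.\<close>

lemma third_point: "3 dvd h a + h b + h (- a - b)"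
proof -
  have "2 *s a = - a" by (simp add: two_eq)
  then have "a + a = - a" using vec.scale_left_distrib[of 1 1 a] by simp
  moreover have "a - (b - a) = (a + a) - b" by (simp add: algebra_simps)
  ultimately have "a - (b - a) = - a - b" by (simp only:)
  moreover have "a + (b - a) = b" by simp
  ultimately show ?thesis using line_sum_dvd[of a "b - a"] by (simp only:)
qed

text \<open>The pairs \<open>a\<close>, \<open>b\<close> and \<open>0\<close>, \<open>a + b\<close>
  have the same third point. So \<open>h v - h 0\<close> is additive in \<open>v\<close> modulo
  3.\<close>

lemma h_affine: "3 dvd h (a + b) - h a - h b + h 0"
  using third_point[of a b] third_point[of 0 "a + b"] by (simp add: dvd_def) presburger

lemma h_translate:
  assumes "3 dvd h v - h 0" shows "3 dvd h (p + t *s v) - h p"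
proof -
  have plus: "3 dvd h (p + v) - h p" for p
    using h_affine[of p v] assms by presburger
  have "t \<in> {0, 1, -1}" using UNIV_3 by blast
  then show ?thesis
    using plus[of p] plus[of "p - v"] by (auto simp: dvd_diff_commute)
qed

text \<open>The values at \<open>b\<close>, \<open>b + a\<close> and \<open>b - a\<close> run
  through all residues modulo 3.\<close>

lemma h_direction_correct:
  assumes "\<not> 3 dvd h a - h 0" shows "\<exists>t. 3 dvd h (b + t *s a) - h 0"
proof -
  have "3 dvd h (b + 0 *s a) - h 0 \<or> 3 dvd h (b + 1 *s a) - h 0 \<or> 3 dvd h (b + (-1) *s a) - h 0"
    using assms h_affine[of b a] h_affine[of b "-a"] h_affine[of a "-a"] by simp presburger
  then show ?thesis by blast
qed

text \<open>The kernel of a linear functional on a 3-dimensional space has dimension at least 2. A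
  basis vector outside it is used to correct other basis vectors.\<close>

lemma obtain_level_plane:
  obtains v w where "indep v w" "3 dvd h v - h 0" "3 dvd h w - h 0"
proof -
  define e1 e2 e3 where e: "e1 = (axis 1 1 :: 'a ^ 3)" "e2 = (axis 2 1 :: 'a ^ 3)" "e3 = (axis 3 1 :: 'a ^ 3)"
  note indep_simps = e indep_def vec_eq_iff axis_def forall_3
  show thesis
  proof (cases "3 dvd h e1 - h 0")
    case False
    then obtain s t where "3 dvd h (e2 + s *s e1) - h 0" "3 dvd h (e3 + t *s e1) - h 0"
      using h_direction_correct by blast
    moreover have "indep (e2 + s *s e1) (e3 + t *s e1)" by (auto simp: indep_simps)
    ultimately show ?thesis using that by blast
  next
    case 1: True
    show ?thesis
    proof (cases "3 dvd h e2 - h 0")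
      case True
      moreover have "indep e1 e2" by (auto simp: indep_simps)
      ultimately show ?thesis using that 1 by blast
    next
      case False
      then obtain t where "3 dvd h (e3 + t *s e2) - h 0"
        using h_direction_correct by blast
      moreover have "indep e1 (e3 + t *s e2)" by (auto simp: indep_simps)
      ultimately show ?thesis using that 1 by blast
    qed
  qed
qed

text \<open>The bounds leave only the values \<open>-1\<close> and \<open>2\<close>, and a
  monochromatic line would have sum \<open>-3\<close> or \<open>6\<close> instead of
  \<open>0\<close> or \<open>3\<close>. But five of the nine points share a colour, and five points
  of AG(2,3) always contain a line.\<close>

lemma no_plane_cong_2:
  assumes i: "indep v w" and two: "\<And>s t. 3 dvd h (p + s *s v + t *s w) - 2"
  shows False
proof -
  define B where "B s t \<longleftrightarrow> h (p + s *s v + t *s w) = 2" for s t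
  have vals: "h (p + s *s v + t *s w) = (if B s t then 2 else -1)" for s t
    using two[of s t] h_bounds_3[of "p + s *s v + t *s w"] unfolding B_def by presburger
  have *: "\<not> (B s t \<and> B (s + a) (t + b) \<and> B (s - a) (t - b))
      \<and> (B s t \<or> B (s + a) (t + b) \<or> B (s - a) (t - b))" if ab: "a \<noteq> 0 \<or> b \<noteq> 0" for s t a b
  proof -
    let ?p = "p + s *s v + t *s w" and ?u = "a *s v + b *s w"
    have u: "?u \<noteq> 0" using i ab unfolding indep_def by blast
    have "?p + ?u = p + (s + a) *s v + (t + b) *s w" "?p - ?u = p + (s - a) *s v + (t - b) *s w"
      by (simp_all add: vec.scale_left_distrib vec.scale_left_diff_distrib)
    then have "h ?p + h (p + (s + a) *s v + (t + b) *s w) + h (p + (s - a) *s v + (t - b) *s w)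
        = 3 * F ?u ?p"
      using line_sum_3[OF u, of ?p] by (simp only:)
    then show ?thesis
      using F_bounds[of ?u ?p] unfolding vals by (auto split: if_splits)
  qed
  show False
    \<comment> \<open>The twelve lines of AG(2,3): four directions \<open>(a, b)\<close> with three
      base points \<open>(s, t)\<close> each.\<close>
    using *[of 1 0 0 0] *[of 1 0 0 1] *[of 1 0 0 "-1"]
      *[of 0 1 0 0] *[of 0 1 1 0] *[of 0 1 "-1" 0]
      *[of 1 1 0 0] *[of 1 1 0 1] *[of 1 1 0 "-1"]
      *[of 1 "-1" 0 0] *[of 1 "-1" 0 1] *[of 1 "-1" 0 "-1"]
    by (simp add: two_eq) argo
qed

text \<open>Modulo 3, \<open>h\<close> is constant on the translate through \<open>p\<close> of a
  level plane.\<close>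

lemma h_not_cong_2: "\<not> 3 dvd h p - 2"
proof
  assume p: "3 dvd h p - 2"
  obtain v w where vw: "indep v w" "3 dvd h v - h 0" "3 dvd h w - h 0"
    by (rule obtain_level_plane)
  have "3 dvd h (p + s *s v + t *s w) - 2" for s t
    using p h_translate[OF vw(2), of p s] h_translate[OF vw(3), of "p + s *s v" t] by presburger
  then show False using no_plane_cong_2[OF vw(1)] by blast
qed

lemma classification_3:
  "L = {} \<or> (\<exists>p. L = ag_lines_through p) \<or>
    (\<exists>p. L = ag_lines - ag_lines_through p) \<or> L = ag_lines"
proof -
  \<comment> \<open>Three residues from \<open>0\<close> and \<open>1\<close> with sum divisible by
    3 are all equal.\<close>
  have cong: "3 dvd h v - h 0" for v
    using h_not_cong_2[of 0] h_not_cong_2[of v] h_not_cong_2[of "- 0 - v"] third_point[of 0 v]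
    by presburger
  have "(\<forall>v. q dvd h v) \<or> (\<forall>v. q dvd 1 - h v)"
  proof (cases "3 dvd h 0")
    case True
    then have "3 dvd h v" for v using cong[of v] by presburger
    then show ?thesis using card3 by simp
  next
    case False
    then have "3 dvd 1 - h v" for v using cong[of v] h_not_cong_2[of 0] by presburger
    then show ?thesis using card3 by simp
  qed
  then show ?thesis using trivial_of_h_cong_0 trivial_of_h_cong_1 by blast
qed

end

theorem theorem6p2:
  fixes q :: nat
    and L :: "('a::{field,finite} ^ 3) set set"
  assumes "q \<in> {2, 3}"
    and "CARD('a) = q"
    and "cameron_liebler L"
  shows "L = {} \<or>
         (\<exists>p. L = ag_lines_through p) \<or>
         (\<exists>p. L = ag_lines - ag_lines_through p) \<or>
         L = ag_lines"
proof -
  obtain x where "cameron_liebler_param x L"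
    using assms(3) unfolding cameron_liebler_def by blast
  then interpret cl_class L x "int CARD('a)" by unfold_locales simp_all
  from assms(1,2) consider "CARD('a) = 2" | "CARD('a) = 3" by auto
  then show ?thesis
  proof cases
    case 1
    then show ?thesis by (rule classification_2)
  next
    case 2
    then interpret cl_class_3 L x "int CARD('a)" by unfold_locales simp_all
    show ?thesis by (rule classification_3)
  qed
qed

end
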